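(* Suppose $G$ is a prime Gauss diagram of size $n\ge 2$ which is not a wheel Gauss diagram. Then $G$ can be produced by a teepee move from a prime Gauss diagram of size $n-1$.
   Context: A Gauss diagram of size $n$ is a circle with $2n$ distinct points on it, called vertices, joined in pairs by $n$ chords (each vertex is the endpoint of exactly one chord), such that every chord is intersected by an even number of other chords (condition PC1, which is here part of the definition of a Gauss diagram). Two chords intersect (interlace) if their endpoints alternate around the circle. Diagrams are considered up to isomorphism. A Gauss diagram is prime if its interlacement graph (vertices: chords; edges: pairs of intersecting chords) is connected. An arc is a part of the circumference of the circle between two consecutive vertices; the arc between consecutive vertices $p,q$ is denoted $(p,q)$. A wheel Gauss diagram of size $n$ is one whose vertices, listed consecutively around the circle, are $v_1,\dots,v_{2n}$ and whose chords are $(v_i,v_{n+i})$ for $1\le i\le n$. Teepee move on a Gauss diagram: choose one of its chords $(u,v)$ and one of its arcs $(p,q)$. Insert two new vertices $p^{\sharp},q^{\flat}$ between $p$ and $q$, so that the arc $(p,q)$ is split into three consecutive arcs $(p,p^{\sharp})$, $(p^{\sharp},q^{\flat})$, $(q^{\flat},q)$. Delete the chord $(u,v)$ (keeping the vertices $u,v$). Add either the two new chords $(u,p^{\sharp})$ and $(v,q^{\flat})$, or the two new chords $(v,p^{\sharp})$ and $(u,q^{\flat})$; exactly one of these two choices preserves condition PC1 in the newly formed diagram, and that one is chosen. *)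

theory Defs
  imports Main "HOL-Library.Disjoint_Sets"
begin

text \<open>
  A chord diagram of size \<open>n\<close> is represented by its set of chords on the vertices
  \<open>0, \<dots>, 2n - 1\<close>, numbered consecutively around the circle; after \<open>2n - 1\<close> comes \<open>0\<close> again.
  A chord is the set of its two endpoints.
\<close>

type_synonym diagram = "nat set set"

definition chord_diagram :: "nat \<Rightarrow> diagram \<Rightarrow> bool" where
  "chord_diagram n C \<longleftrightarrow> partition_on {..<2 * n} C \<and> (\<forall>c\<in>C. card c = 2)"

text \<open>
  Alternation of four points around a circle is unchanged by moving the origin of the numbering,
  so it can be tested with the linear order on the labels.
\<close>

definition interlaced :: "nat set \<Rightarrow> nat set \<Rightarrow> bool" where
  "interlaced c d \<longleftrightarrow>
     (\<exists>a x b y. a < x \<and> x < b \<and> b < y \<and>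
        (c = {a, b} \<and> d = {x, y} \<or> c = {x, y} \<and> d = {a, b}))"

definition PC1 :: "diagram \<Rightarrow> bool" where
  "PC1 C \<longleftrightarrow> (\<forall>c\<in>C. even (card {d \<in> C. interlaced c d}))"

definition gauss_diagram :: "nat \<Rightarrow> diagram \<Rightarrow> bool" where
  "gauss_diagram n C \<longleftrightarrow> chord_diagram n C \<and> PC1 C"

definition interlacement_edges :: "diagram \<Rightarrow> (nat set \<times> nat set) set" where
  "interlacement_edges C = {(c, d). c \<in> C \<and> d \<in> C \<and> interlaced c d}"

text \<open>Connectedness of the interlacement graph; the edge relation is symmetric.\<close>

definition prime_diagram :: "diagram \<Rightarrow> bool" where
  "prime_diagram C \<longleftrightarrow> (\<forall>c\<in>C. \<forall>d\<in>C. (c, d) \<in> (interlacement_edges C)\<^sup>*)"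

text \<open>
  Two diagrams are identified if they differ by the choice of the vertex that is numbered \<open>0\<close>.
  Reflections are not included. A mirror image of a diagram obtained by a teepee move is obtained
  by a teepee move from the mirror image, and wheels are their own mirror images, so being
  obtainable by a teepee move up to rotation or up to rotation and reflection is the same.
\<close>

definition isomorphic :: "nat \<Rightarrow> diagram \<Rightarrow> diagram \<Rightarrow> bool" where
  "isomorphic n C D \<longleftrightarrow> (\<exists>k. D = image (\<lambda>i. (i + k) mod (2 * n)) ` C)"

definition wheel :: "nat \<Rightarrow> diagram" where
  "wheel n = {{i, n + i} | i. i < n}"

definition is_wheel :: "nat \<Rightarrow> diagram \<Rightarrow> bool" where
  "is_wheel n C \<longleftrightarrow> isomorphic n (wheel n) C"

text \<open>
  The arc with number \<open>p < 2n\<close> goes from \<open>p\<close> to the next vertex, \<open>p + 1\<close> or, for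
  \<open>p = 2n - 1\<close>, \<open>0\<close>. Inserting two vertices into it renumbers the old vertices by
  \<open>renumber p\<close>, and the new vertices get the numbers \<open>p + 1\<close> and \<open>p + 2\<close>.
\<close>

definition renumber :: "nat \<Rightarrow> nat \<Rightarrow> nat" where
  "renumber p i = (if i \<le> p then i else i + 2)"

definition split_chord :: "diagram \<Rightarrow> nat \<Rightarrow> nat \<Rightarrow> nat \<Rightarrow> diagram" where
  "split_chord C u v p =
     image (renumber p) ` (C - {{u, v}}) \<union> {{renumber p u, p + 1}, {renumber p v, p + 2}}"

text \<open>
  As \<open>{u, v} = {v, u}\<close>, the two possible pairs of new chords are \<open>split_chord C u v p\<close> and
  \<open>split_chord C v u p\<close>; both are covered by the quantification over \<open>u\<close> and \<open>v\<close>.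
\<close>

definition teepee_move :: "nat \<Rightarrow> diagram \<Rightarrow> diagram \<Rightarrow> bool" where
  "teepee_move n C D \<longleftrightarrow>
     (\<exists>u v p. {u, v} \<in> C \<and> p < 2 * n \<and> D = split_chord C u v p \<and> PC1 D)"

end

theory Submission
  imports Defs
begin

text \<open>
  A diagram is encoded by the fixed-point free involution \<open>f\<close> on the vertices \<open>{..<N}\<close>,
  \<open>N = 2 * n\<close>, that sends each vertex to its partner. Two dictionary entries translate the
  hypotheses. Condition PC1 says that partners have opposite parity, because the number of chords
  that cross a chord has the parity of the number of vertices between its ends
  (\<open>PC1_diagram_of_iff\<close>). Primeness says that no proper nonempty cyclic interval of vertices is
  closed under \<open>f\<close>: a component of the interlacement graph lies inside the interval from its first
  to its last vertex, and this interval is closed (\<open>prime_imp_leaving\<close>,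
  \<open>not_prime_imp_closed\<close>).

  A teepee move is undone at an arc \<open>(x, y)\<close> by deleting \<open>x\<close> and \<open>y\<close> and joining their
  partners \<open>u\<close> and \<open>v\<close> by a chord. By the parity criterion the result \<open>H\<close> is always a Gauss
  diagram. If \<open>H\<close> is not prime, then it has a closed proper interval, and as \<open>G\<close> is prime, the
  only way for this to happen is that in \<open>G\<close> there is a cyclic interval \<open>J\<close> that contains
  \<open>x\<close>, \<open>y\<close> and a neighbour on either side, such that the chords of \<open>x\<close> and \<open>y\<close> are the only
  chords that leave \<open>J\<close> (\<open>not_prime_merge\<close>).

  It remains to see that \<open>G\<close> is a wheel if there is such a \<open>J\<close> for every arc. The argument
  uncrosses pairs of cyclic intervals: if two of them cut the circle into four nonempty parts, then
  these parts are again cyclic intervals, and few chords leave each of them.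

  \<^item> \<open>one_chord_cut_trivial\<close>: if exactly one chord leaves a cyclic interval \<open>X\<close>, then \<open>X\<close> or
    its complement is a single vertex. In a smallest counterexample let \<open>e\<close> be the last vertex
    of \<open>X\<close>, and take the interval \<open>J\<close> of the arc from \<open>e\<close> to the next vertex. If \<open>J\<close> does not
    contain the end in \<open>X\<close> of the leaving chord, then \<open>X \<inter> J - {e}\<close> is closed. Otherwise exactly
    one chord leaves \<open>X - J\<close>, so that by minimality \<open>X - J\<close> consists of the partner of \<open>e\<close>,
    which is then the first vertex of \<open>X\<close>. But \<open>X\<close> has odd size, which contradicts the opposite
    parity of partners.

  \<^item> \<open>partners_adjacent\<close>: for consecutive vertices \<open>x, y, z\<close> take \<open>J\<close> for \<open>(x, y)\<close> and \<open>K\<close>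
    for \<open>(y, z)\<close>. Only one chord leaves \<open>K - J\<close>, and only one leaves the complement of
    \<open>J \<union> K\<close>, so these two sets are the singletons of \<open>f x\<close> and \<open>f y\<close>. Hence the complement of
    \<open>J\<close> is the cyclic interval \<open>{f x, f y}\<close>, and the partners of neighbours are neighbours.

  \<^item> \<open>antipodal\<close>: by injectivity, \<open>f\<close> runs around the circle in one direction. If it runs
    backwards, it meets itself in a fixed point or in a chord that joins two neighbours, which is
    impossible. So \<open>f\<close> is a rotation, and as an involution it is the rotation by \<open>n\<close>.
\<close>

section \<open>Cyclic intervals\<close>

text \<open>
  Sets of consecutive vertices on a circle with the vertices \<open>0, \<dots>, N - 1\<close>. An interval that
  passes through the origin is the complement of a linear one. The empty set and the whole circle
  are included.
\<close>

definition cyc_interval :: "nat \<Rightarrow> nat set \<Rightarrow> bool" where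
  "cyc_interval N A \<longleftrightarrow> (\<exists>a b. a \<le> b \<and> b \<le> N \<and> (A = {a..<b} \<or> A = {..<N} - {a..<b}))"

text \<open>The vertex after \<open>i\<close> on the circle with \<open>N\<close> vertices.\<close>

definition nxt :: "nat \<Rightarrow> nat \<Rightarrow> nat" where
  "nxt N i = (if Suc i = N then 0 else Suc i)"

text \<open>
  If \<open>f\<close> sends each vertex to its partner, these are the ends in \<open>A\<close> of the chords that have
  exactly one end in \<open>A\<close>.
\<close>

definition leaving :: "(nat \<Rightarrow> nat) \<Rightarrow> nat set \<Rightarrow> nat set" where
  "leaving f A = {i \<in> A. f i \<notin> A}"

lemma nxt_eq_mod: "i < N \<Longrightarrow> nxt N i = Suc i mod N"
  by (auto simp: nxt_def)

lemma nxt_less: "i < N \<Longrightarrow> nxt N i < N"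
  by (auto simp: nxt_def)

lemma nxt_inj: "i < N \<Longrightarrow> j < N \<Longrightarrow> nxt N i = nxt N j \<Longrightarrow> i = j"
  by (auto simp: nxt_def split: if_splits)

lemma nxt_surj:
  assumes "i < N" obtains w where "w < N" "nxt N w = i"
proof (cases i)
  case 0
  then show ?thesis using assms that[of "N - 1"] by (auto simp: nxt_def)
next
  case (Suc m)
  then show ?thesis using assms that[of m] by (auto simp: nxt_def)
qed

lemma cyc_interval_lin: "a \<le> b \<Longrightarrow> b \<le> N \<Longrightarrow> cyc_interval N {a..<b}"
  unfolding cyc_interval_def by blast

lemma cyc_interval_colin: "a \<le> b \<Longrightarrow> b \<le> N \<Longrightarrow> cyc_interval N ({..<N} - {a..<b})"
  unfolding cyc_interval_def by blast

lemma cyc_interval_subset: "cyc_interval N A \<Longrightarrow> A \<subseteq> {..<N}"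
  unfolding cyc_interval_def by auto

lemma cyc_interval_cases:
  assumes "cyc_interval N A"
  obtains (lin) a b where "a \<le> b" "b \<le> N" "A = {a..<b}"
        | (colin) a b where "a \<le> b" "b \<le> N" "A = {..<N} - {a..<b}"
  using assms unfolding cyc_interval_def by blast

lemma cyc_interval_compl: "cyc_interval N A \<Longrightarrow> cyc_interval N ({..<N} - A)"
proof (erule cyc_interval_cases)
  fix a b assume "a \<le> b" "b \<le> N" "A = {..<N} - {a..<b}"
  moreover from this have "{..<N} - A = {a..<b}" by auto
  ultimately show ?thesis by (simp add: cyc_interval_lin)
qed (simp add: cyc_interval_colin)

lemma cyc_interval_Int_aux:
  assumes "a \<le> b" "b \<le> N" "c \<le> d" "d \<le> N"
    and "{c..<d} - {a..<b} \<noteq> {}"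
  shows "cyc_interval N ({a..<b} - {c..<d})"
proof -
  from assms(5) have *: "c < d" "c < a \<or> b < d" by auto
  show ?thesis
  proof (cases "c < a")
    case True
    then have "{a..<b} - {c..<d} = {max a (min b d)..<b}" using assms * by auto
    moreover have "max a (min b d) \<le> b" using assms by auto
    ultimately show ?thesis using assms cyc_interval_lin by metis
  next
    case False
    then have "{a..<b} - {c..<d} = {a..<max a (min b c)}" using assms * by auto
    moreover have "max a (min b c) \<le> N" using assms by auto
    ultimately show ?thesis using assms cyc_interval_lin[of a "max a (min b c)" N] by simp
  qed
qed

text \<open>
  Two intervals that together do not cover the circle meet in at most one piece. With complements
  this yields that all four parts cut out by two intervals are intervals if none of them is empty.
\<close>

lemma cyc_interval_Int:
  assumes "cyc_interval N A" "cyc_interval N B" and co: "{..<N} - (A \<union> B) \<noteq> {}"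
    shows "cyc_interval N (A \<inter> B)"
  using assms(1)
proof (cases rule: cyc_interval_cases)
  case A: (lin a b)
  from assms(2) show ?thesis
  proof (cases rule: cyc_interval_cases)
    case B: (lin c d)
    have "A \<inter> B = {max a c..<max (max a c) (min b d)}" using A B by auto
    then show ?thesis using A B by (simp add: cyc_interval_lin)
  next
    case B: (colin c d)
    have "A \<inter> B = {a..<b} - {c..<d}" using A B by auto
    moreover have "{c..<d} - {a..<b} \<noteq> {}" using A B co by auto
    ultimately show ?thesis using A B cyc_interval_Int_aux by metis
  qed
next
  case A: (colin a b)
  from assms(2) show ?thesis
  proof (cases rule: cyc_interval_cases)
    case B: (lin c d)
    have "A \<inter> B = {c..<d} - {a..<b}" using A B by auto
    moreover have "{a..<b} - {c..<d} \<noteq> {}" using A B co by auto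
    ultimately show ?thesis using A B cyc_interval_Int_aux by metis
  next
    case B: (colin c d)
    have "{a..<b} \<inter> {c..<d} \<noteq> {}" using A B co by auto
    then have "{a..<b} \<union> {c..<d} = {min a c..<max b d}" by auto
    moreover have "A \<inter> B = {..<N} - ({a..<b} \<union> {c..<d})" using A B by auto
    ultimately show ?thesis using A B cyc_interval_colin[of "min a c" "max b d" N] by auto
  qed
qed

lemma cyc_interval_Diff:
  assumes "cyc_interval N A" "cyc_interval N B" "B - A \<noteq> {}"
  shows "cyc_interval N (A - B)"
proof -
  have "A - B = A \<inter> ({..<N} - B)" using cyc_interval_subset[OF assms(1)] by auto
  moreover have "{..<N} - (A \<union> ({..<N} - B)) = B - A" using cyc_interval_subset[OF assms(2)] by auto
  ultimately show ?thesis
    using cyc_interval_Int[OF assms(1) cyc_interval_compl[OF assms(2)]] assms(3) by simp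
qed

lemma cyc_interval_single: "i < N \<Longrightarrow> cyc_interval N {i}"
  using cyc_interval_lin[of i "Suc i" N] by simp

lemma cyc_interval_arc:
  assumes "i < N"
  shows "cyc_interval N {i, nxt N i}"
proof (cases "Suc i = N")
  case True
  show ?thesis
  proof (cases "i = 0")
    case True
    then show ?thesis using cyc_interval_single[OF assms] \<open>Suc i = N\<close> by (simp add: nxt_def)
  next
    case False
    have "{i, nxt N i} = {..<N} - {1..<i}" using True False by (auto simp: nxt_def)
    moreover have "cyc_interval N ({..<N} - {1..<i})" using False assms by (intro cyc_interval_colin) auto
    ultimately show ?thesis by (simp only:)
  qed
next
  case False
  have "{i, nxt N i} = {i..<i + 2}" using False by (auto simp: nxt_def)
  moreover have "cyc_interval N {i..<i + 2}" using False assms by (intro cyc_interval_lin) auto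
  ultimately show ?thesis by (simp only:)
qed

lemma cyc_interval_last:
  assumes "cyc_interval N A" "A \<noteq> {}" "A \<noteq> {..<N}"
  obtains e where "e \<in> A" "nxt N e \<notin> A"
  using assms(1)
proof (cases rule: cyc_interval_cases)
  case (lin a b)
  then have "a < b" "\<not> (a = 0 \<and> b = N)" using assms by auto
  then show ?thesis using lin that[of "b - 1"] by (auto simp: nxt_def)
next
  case (colin a b)
  then have "a < b" "\<not> (a = 0 \<and> b = N)" using assms by auto
  show ?thesis
  proof (cases "a = 0")
    case True
    have "N - 1 \<in> A" "nxt N (N - 1) \<notin> A"
      using colin True \<open>a < b\<close> \<open>\<not> (a = 0 \<and> b = N)\<close> by (auto simp: nxt_def)
    then show ?thesis using that by blast
  next
    case False
    have "a - 1 \<in> A" "nxt N (a - 1) \<notin> A"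
      using colin False \<open>a < b\<close> by (auto simp: nxt_def)
    then show ?thesis using that by blast
  qed
qed

lemma cyc_interval_remove_last:
  assumes "cyc_interval N A" "e \<in> A" "nxt N e \<notin> A"
  shows "cyc_interval N (A - {e})"
  using assms(1)
proof (cases rule: cyc_interval_cases)
  case (lin a b)
  then have e: "e = b - 1" "a \<le> b - 1" "b - 1 \<le> N"
    using assms(2,3) by (auto simp: nxt_def split: if_splits)
  have "A - {e} = {a..<b - 1}" unfolding lin(3) e(1) using assms(2) lin(3) by auto
  then show ?thesis using cyc_interval_lin[OF e(2,3)] by (simp only:)
next
  case (colin a b)
  show ?thesis
  proof (cases "a = 0")
    case True
    then have e: "e = N - 1" "b \<le> N - 1" "N - 1 \<le> N"
      using colin assms(2,3) by (auto simp: nxt_def split: if_splits)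
    have "A - {e} = {b..<N - 1}" unfolding colin(3) e(1) True by auto
    then show ?thesis using cyc_interval_lin[OF e(2,3)] by (simp only:)
  next
    case False
    then have e: "e = a - 1" "a - 1 \<le> b"
      using colin assms(2,3) by (auto simp: nxt_def split: if_splits)
    have "A - {e} = {..<N} - {a - 1..<b}" unfolding colin(3) e(1) using False colin by auto
    then show ?thesis using cyc_interval_colin[OF e(2) colin(2)] by (simp only:)
  qed
qed

lemma cyc_interval_remove_first:
  assumes "cyc_interval N A" "e < N" "e \<notin> A" "nxt N e \<in> A"
  shows "cyc_interval N (A - {nxt N e})"
  using assms(1)
proof (cases rule: cyc_interval_cases)
  case (lin a b)
  then have e: "nxt N e = a" "a + 1 \<le> b"
    using assms(2-4) by (auto simp: nxt_def split: if_splits)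
  have "A - {nxt N e} = {a + 1..<b}" unfolding lin(3) e(1) by auto
  then show ?thesis using cyc_interval_lin[OF e(2) lin(2)] by (simp only:)
next
  case (colin a b)
  show ?thesis
  proof (cases "b = N")
    case True
    then have e: "nxt N e = 0" "1 \<le> a"
      using colin assms(2-4) by (auto simp: nxt_def split: if_splits)
    have "a \<le> N" using colin by simp
    have "A - {nxt N e} = {1..<a}" unfolding colin(3) e(1) True using \<open>a \<le> N\<close> by auto
    then show ?thesis using cyc_interval_lin[OF e(2) \<open>a \<le> N\<close>] by (simp only:)
  next
    case False
    then have e: "nxt N e = b" "a \<le> b + 1" "b + 1 \<le> N"
      using colin assms(2-4) by (auto simp: nxt_def split: if_splits)
    have "A - {nxt N e} = {..<N} - {a..<b + 1}" unfolding colin(3) e(1) using colin(1) by auto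
    then show ?thesis using cyc_interval_colin[OF e(2,3)] by (simp only:)
  qed
qed

lemma cyc_interval_pred:
  assumes "cyc_interval N A" "w < N" "nxt N w \<in> A" "nxt N (nxt N w) \<notin> A" "A \<noteq> {nxt N w}"
  shows "w \<in> A"
proof (rule ccontr)
  assume w: "w \<notin> A"
  define e where "e = nxt N w"
  have e: "e \<in> A" "e < N" "nxt N e \<notin> A" "A \<noteq> {e}"
    using assms nxt_less unfolding e_def by blast+
  from assms(1) show False
  proof (cases rule: cyc_interval_cases)
    case (lin a b)
    have "e = a" using w e(1) unfolding e_def lin(3)
      by (auto simp: nxt_def split: if_splits)
    moreover have "e = b - 1" using e(1,3) lin(2) unfolding lin(3)
      by (auto simp: nxt_def split: if_splits)
    ultimately have "A = {e}" using e(1) lin(3) by auto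
    then show False using e(4) by simp
  next
    case (colin a b)
    have "e = (if b = N then 0 else b)" using w e(1) assms(2) colin(1,2) unfolding e_def colin(3)
      by (auto simp: nxt_def split: if_splits)
    moreover have "Suc e = (if a = 0 then N else a)" using e(1,3) colin(1,2) unfolding colin(3)
      by (auto simp: nxt_def split: if_splits)
    ultimately have "A = {e}" using e(1) colin(1,2) unfolding colin(3)
      by (auto split: if_splits)
    then show False using e(4) by simp
  qed
qed

lemma cyc_interval_two:
  assumes "cyc_interval N {u, v}" "u \<noteq> v"
  shows "v = nxt N u \<or> u = nxt N v"
proof -
  have uv: "u < N" "v < N" using cyc_interval_subset[OF assms(1)] by auto
  obtain e where e: "e \<in> {u, v}" "nxt N e \<in> {u,v}" "nxt N e \<noteq> e"
  proof (cases "{u,v} = {..<N}")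
    case True
    have "nxt N u \<noteq> u" using uv assms by (auto simp: nxt_def)
    moreover have "nxt N u \<in> {u,v}" using nxt_less[OF uv(1)] unfolding True by simp
    ultimately show ?thesis using that[of u] by blast
  next
    case False
    from cyc_interval_last[OF assms(1) _ False] obtain e where e: "e \<in> {u,v}" "nxt N e \<notin> {u,v}" by blast
    obtain w where w: "w < N" "nxt N w = e" using nxt_surj e uv by (metis insertE singletonD)
    have "w \<in> {u,v}" using cyc_interval_pred[OF assms(1) w(1)] w e assms(2) by auto
    then show ?thesis using that[of w] e w assms(2) by auto
  qed
  then show ?thesis by auto
qed

lemma cyc_interval_rot1:
  assumes "cyc_interval N A"
  shows "cyc_interval N (nxt N ` A)"
proof -
  have linear: "cyc_interval N (nxt N ` {a..<b})" if "a \<le> b" "b \<le> N" for a b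
  proof (cases "b = N")
    case True
    show ?thesis
    proof (cases "a = N")
      case True then show ?thesis using \<open>b = N\<close> cyc_interval_lin[of 0 0 N] by simp
    next
      case False
      have "x \<in> nxt N ` {a..<b}" if "x \<in> {..<N} - {1..<Suc a}" for x
      proof -
        have "x = nxt N (if x = 0 then N - 1 else x - 1)" using that by (auto simp: nxt_def)
        moreover have "(if x = 0 then N - 1 else x - 1) \<in> {a..<b}"
          using that \<open>b = N\<close> \<open>a \<le> b\<close> False by auto
        ultimately show ?thesis by blast
      qed
      moreover have "nxt N ` {a..<b} \<subseteq> {..<N} - {1..<Suc a}" using True by (auto simp: nxt_def)
      ultimately have "nxt N ` {a..<b} = {..<N} - {1..<Suc a}" by blast
      then show ?thesis using cyc_interval_colin[of 1 "Suc a" N] that False by auto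
    qed
  next
    case False
    then have "nxt N ` {a..<b} = Suc ` {a..<b}"
      using that by (intro image_cong) (auto simp: nxt_def)
    then show ?thesis using that False cyc_interval_lin[of "Suc a" "Suc b" N] by simp
  qed
  from assms show ?thesis
  proof (cases rule: cyc_interval_cases)
    case (lin a b)
    then show ?thesis using linear by simp
  next
    case (colin a b)
    have inj: "inj_on (nxt N) {..<N}" using nxt_inj by (auto simp: inj_on_def)
    have surj: "nxt N ` {..<N} = {..<N}"
      by (rule endo_inj_surj) (use inj nxt_less in auto)
    have "nxt N ` A = nxt N ` {..<N} - nxt N ` {a..<b}"
      unfolding colin using inj by (rule inj_on_image_set_diff) (use colin in auto)
    then show ?thesis using surj cyc_interval_compl[OF linear[OF colin(1,2)]] by simp
  qed
qed

lemma cyc_interval_rot: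
  assumes "cyc_interval N A"
  shows "cyc_interval N ((\<lambda>i. (i + k) mod N) ` A)"
proof (induction k)
  case 0
  have "(\<lambda>i. (i + 0) mod N) ` A = id ` A"
    using cyc_interval_subset[OF assms] by (intro image_cong) auto
  then show ?case using assms by simp
next
  case (Suc k)
  have "(\<lambda>i. (i + Suc k) mod N) ` A = nxt N ` (\<lambda>i. (i + k) mod N) ` A"
    unfolding image_image using cyc_interval_subset[OF assms]
    by (intro image_cong) (auto simp: nxt_def mod_Suc)
  then show ?case using cyc_interval_rot1[OF Suc] by simp
qed

lemma cyc_interval_last_unique:
  assumes "cyc_interval N A" "d \<in> A" "nxt N d \<notin> A" "e \<in> A" "nxt N e \<notin> A"
  shows "d = e"
  using assms(1)
proof (cases rule: cyc_interval_cases)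
  case (lin a b)
  have "x = b - 1" if "x \<in> A" "nxt N x \<notin> A" for x
    using that lin(2) unfolding lin(3) by (auto simp: nxt_def split: if_splits)
  then show ?thesis using assms by metis
next
  case (colin a b)
  have "Suc x = (if a = 0 then N else a)" if "x \<in> A" "nxt N x \<notin> A" for x
    using that colin(1,2) unfolding colin(3) by (auto simp: nxt_def split: if_splits)
  then show ?thesis using assms by (metis Suc_inject)
qed

lemma cyc_interval_odd_ends:
  assumes "cyc_interval N A" "even N" "odd (card A)"
    and "e \<in> A" "nxt N e \<notin> A" "w < N" "w \<notin> A" "nxt N w \<in> A"
  shows "even (e + nxt N w)"
  using assms(1)
proof (cases rule: cyc_interval_cases)
  case (lin a b)
  have "e = b - 1"
    using assms(4,5) lin(2) unfolding lin(3) by (auto simp: nxt_def split: if_splits)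
  moreover have "nxt N w = a"
    using assms(6-8) unfolding lin(3) by (auto simp: nxt_def split: if_splits)
  moreover have "odd (b - a)" using assms(3) unfolding lin(3) by simp
  ultimately show ?thesis using lin(1) by (cases b) auto
next
  case (colin a b)
  have e: "Suc e = (if a = 0 then N else a)"
    using assms(4,5) colin(1,2) unfolding colin(3) by (auto simp: nxt_def split: if_splits)
  have w: "nxt N w = (if b = N then 0 else b)"
    using assms(6-8) colin(1,2) unfolding colin(3) by (auto simp: nxt_def split: if_splits)
  have "card A = N - (b - a)"
    unfolding colin(3) using colin(1,2) by (subst card_Diff_subset) auto
  then have "odd (a + b)" using assms(2,3) colin(1,2) by auto
  moreover have "even (Suc e + a)" using e assms(2) by (auto split: if_splits)
  moreover have "even (nxt N w + b)" using w assms(2) by (auto split: if_splits)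
  ultimately show ?thesis by auto
qed

lemma mod_add_right_cancel:
  fixes a b m N :: nat
  assumes "(a + m) mod N = (b + m) mod N" "a < N" "b < N"
  shows "a = b"
proof -
  obtain q r where "a + m + N * q = b + m + N * r"
    using assms(1) nat_mod_eq_iff by blast
  then have "(a + N * q) mod N = (b + N * r) mod N" by simp
  then show ?thesis using assms(2,3) by simp
qed

section \<open>Pairings and their cuts\<close>

text \<open>The partner function of a chord diagram with \<open>N\<close> vertices.\<close>

locale pairing =
  fixes N :: nat and f :: "nat \<Rightarrow> nat"
  assumes lt: "i < N \<Longrightarrow> f i < N"
    and inv: "i < N \<Longrightarrow> f (f i) = i"
    and neq: "i < N \<Longrightarrow> f i \<noteq> i"
begin

text \<open>The vertices of \<open>A\<close> that do not leave \<open>A\<close> come in pairs.\<close>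

lemma even_card_leaving:
  assumes "A \<subseteq> {..<N}"
  shows "even (card (leaving f A)) \<longleftrightarrow> even (card A)"
proof -
  define L where "L = {i \<in> A. f i \<in> A \<and> i < f i}"
  define R where "R = {i \<in> A. f i \<in> A \<and> f i < i}"
  have fin: "finite A" using assms finite_subset by blast
  have A: "A = leaving f A \<union> (L \<union> R)"
    using assms neq by (auto simp: leaving_def L_def R_def) (metis lessThan_iff linorder_neqE_nat subsetD)
  have fins: "finite L" "finite R" "finite (leaving f A)"
    using fin by (auto simp: L_def R_def leaving_def)
  have "bij_betw f L R"
    by (rule bij_betw_byWitness[where f' = f]) (use assms inv in \<open>auto simp: L_def R_def\<close>)
  then have "card L = card R" by (rule bij_betw_same_card)
  moreover have "card (L \<union> R) = card L + card R"
    by (rule card_Un_disjoint) (use fins in \<open>auto simp: L_def R_def\<close>)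
  moreover have "card A = card (leaving f A) + card (L \<union> R)"
    by (subst A, rule card_Un_disjoint) (use fins in \<open>auto simp: leaving_def L_def R_def\<close>)
  ultimately show ?thesis by auto
qed

lemma leaving_compl:
  assumes "A \<subseteq> {..<N}"
  shows "leaving f ({..<N} - A) = f ` leaving f A"
proof
  show "leaving f ({..<N} - A) \<subseteq> f ` leaving f A"
  proof
    fix i assume i: "i \<in> leaving f ({..<N} - A)"
    then have "f i \<in> leaving f A" "i = f (f i)" using lt inv by (auto simp: leaving_def)
    then show "i \<in> f ` leaving f A" by blast
  qed
  show "f ` leaving f A \<subseteq> leaving f ({..<N} - A)"
    using assms lt inv by (auto simp: leaving_def)
qed

end

section \<open>Pairings with a thin interval around every arc\<close>

text \<open>
  The situation in which no teepee move can be undone within the prime diagrams: around the arc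
  from \<open>nxt N w\<close> to the next vertex there is an interval \<open>J\<close> that extends beyond both ends of the
  arc and is left only by the two chords at the ends of the arc.
\<close>

locale rigid_pairing = pairing +
  assumes four: "4 \<le> N"
    and even_N: "even N"
    and opposite: "i < N \<Longrightarrow> odd (i + f i)"
    and connected: "cyc_interval N A \<Longrightarrow> A \<noteq> {} \<Longrightarrow> A \<noteq> {..<N} \<Longrightarrow> leaving f A \<noteq> {}"
    and thin: "w < N \<Longrightarrow> \<exists>J. cyc_interval N J \<and> w \<in> J \<and> nxt N (nxt N (nxt N w)) \<in> J \<and>
        nxt N w \<in> J \<and> nxt N (nxt N w) \<in> J \<and> leaving f J = {nxt N w, nxt N (nxt N w)}"
begin

lemma nxt_neq: "i < N \<Longrightarrow> nxt N i \<noteq> i" and nxt2_neq: "i < N \<Longrightarrow> nxt N (nxt N i) \<noteq> i"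
  using four by (auto simp: nxt_def)

text \<open>
  By induction on the size of \<open>X\<close>; the thin interval of the arc that crosses the end of \<open>X\<close> cuts
  off a smaller interval that only one chord leaves.
\<close>

lemma one_chord_cut_trivial:
  assumes "cyc_interval N X" "leaving f X = {x}"
  shows "card X = 1 \<or> card X = N - 1"
  using assms
proof (induction "card X" arbitrary: X x rule: less_induct)
  case less
  note X = less.prems
  define U where "U = {..<N}"
  have XU: "X \<subseteq> U" using cyc_interval_subset[OF X(1)] U_def by simp
  have finX: "finite X" using XU finite_subset U_def by blast
  have x: "x \<in> X" "f x \<notin> X" using X(2) by (auto simp: leaving_def)
  have xN: "x < N" using x XU U_def by auto
  have Xin: "f i \<in> X" if "i \<in> X" "i \<noteq> x" for i using X(2) that by (auto simp: leaving_def)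
  have Xout: "f i \<notin> X" if "i < N" "i \<notin> X" "i \<noteq> f x" for i
    using Xin[of "f i"] that inv by metis
  show ?case
  proof (rule ccontr)
    assume nontriv: "\<not> ?thesis"
    have "X \<noteq> U" using x lt xN U_def by auto
    obtain e where e: "e \<in> X" "nxt N e \<notin> X"
      using cyc_interval_last[OF X(1)] x(1) \<open>X \<noteq> U\<close> U_def by blast
    have eN: "e < N" using e XU U_def by auto
    have "e \<noteq> x"
    proof
      assume "e = x"
      then have "cyc_interval N (X - {x})" using cyc_interval_remove_last[OF X(1)] e by simp
      moreover have "X - {x} \<noteq> {}"
        using nontriv x(1) by (metis card_1_singleton_iff insert_Diff One_nat_def)
      moreover have "X - {x} \<noteq> {..<N}" using xN by auto
      moreover have "leaving f (X - {x}) = {}"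
      proof -
        have "f i \<in> X - {x}" if "i \<in> X - {x}" for i
          using Xin[of i] that x inv XU U_def by (metis Diff_iff lessThan_iff singleton_iff subsetD)
        then show ?thesis by (auto simp: leaving_def)
      qed
      ultimately show False using connected by blast
    qed
    have "nxt N e \<noteq> f x"
    proof
      assume nfx: "nxt N e = f x"
      have "cyc_interval N (U - X)" using cyc_interval_compl X(1) U_def by simp
      then have "cyc_interval N (U - X - {f x})"
        using cyc_interval_remove_first[of N "U - X" e] e(1) x(2) eN lt[OF xN] unfolding nfx U_def by auto
      moreover have "U - X - {f x} \<noteq> {}"
      proof
        assume "U - X - {f x} = {}"
        then have "X = U - {f x}" using x XU by auto
        then show False using nontriv lt[OF xN] U_def by simp
      qed
      moreover have "U - X - {f x} \<noteq> {..<N}" using lt[OF xN] by auto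
      moreover have "leaving f (U - X - {f x}) = {}"
      proof -
        have "f i \<in> U - X - {f x}" if "i \<in> U - X - {f x}" for i
          using Xout[of i] that x inv lt U_def by (metis Diff_iff lessThan_iff singleton_iff xN)
        then show ?thesis by (auto simp: leaving_def)
      qed
      ultimately show False using connected by blast
    qed
    obtain w where w: "w < N" "nxt N w = e" using nxt_surj eN by blast
    \<comment> \<open>the thin interval around the arc on which \<open>X\<close> ends\<close>
    obtain J where J: "cyc_interval N J" "w \<in> J" "e \<in> J" "nxt N e \<in> J" "leaving f J = {e, nxt N e}"
      using thin[OF w(1)] w(2) by blast
    have Jin: "f i \<in> J" if "i \<in> J" "i \<noteq> e" "i \<noteq> nxt N e" for i
      using J(5) that by (auto simp: leaving_def)
    have feJ: "f e \<notin> J" "f (nxt N e) \<notin> J" using J(5) by (auto simp: leaving_def)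
    have feX: "f e \<in> X" using Xin e(1) \<open>e \<noteq> x\<close> by blast
    have fnX: "f (nxt N e) \<notin> X" using Xout nxt_less eN e(2) \<open>nxt N e \<noteq> f x\<close> by blast
    have fnN: "f (nxt N e) < N" using lt nxt_less eN by blast
    have cXJ: "cyc_interval N (X \<inter> J)"
      using cyc_interval_Int[OF X(1) J(1)] fnN fnX feJ(2) by auto
    have cXmJ: "cyc_interval N (X - J)"
      using cyc_interval_Diff[OF X(1) J(1)] J(4) e(2) by auto
    have wX: "w \<in> X"
    proof -
      have "X \<noteq> {e}" using nontriv by auto
      then show ?thesis using cyc_interval_pred[OF X(1) w(1)] w(2) e by auto
    qed
    show False
    proof (cases "x \<in> J")
      case False
      \<comment> \<open>no chord leaves \<open>X \<inter> J - {e}\<close>\<close>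
      have "cyc_interval N (X \<inter> J - {e})" using cyc_interval_remove_last[OF cXJ, of e] e J(3) by simp
      moreover have "X \<inter> J - {e} \<noteq> {}" using wX J(2) w nxt_neq[OF w(1)] by auto
      moreover have "X \<inter> J - {e} \<noteq> {..<N}" using eN by auto
      moreover have "leaving f (X \<inter> J - {e}) = {}"
      proof -
        have "f i \<in> X \<inter> J - {e}" if i: "i \<in> X \<inter> J - {e}" for i
        proof -
          have "f i \<in> X" using Xin i False by auto
          moreover have "f i \<in> J" using Jin[of i] i e(2) by auto
          moreover have "f i \<noteq> e"
            using i feJ(1) inv XU U_def by (metis DiffE IntE lessThan_iff subsetD)
          ultimately show ?thesis by auto
        qed
        then show ?thesis by (auto simp: leaving_def)
      qed
      ultimately show False using connected by blast
    next
      case True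
      have "f x \<in> J" using Jin[of x] True \<open>e \<noteq> x\<close> x(1) e(2) by metis
      have "leaving f (X - J) = {f e}"
      proof -
        have "i = f e" if "i \<in> X" "i \<notin> J" "f i \<notin> X - J" for i
        proof -
          have "i < N" using that XU U_def by auto
          have "i \<noteq> x" using that True by auto
          then have "f i \<in> X" using Xin that by auto
          then have "f i \<in> J" using that by auto
          then have "f i = e \<or> f i = nxt N e" using Jin[of "f i"] inv \<open>i < N\<close> that by metis
          then show ?thesis using \<open>f i \<in> X\<close> e(2) inv \<open>i < N\<close> by auto
        qed
        moreover have "f e \<in> leaving f (X - J)"
          using feX feJ(1) inv[OF eN] J(3) by (simp add: leaving_def)
        ultimately show ?thesis by (auto simp: leaving_def)
      qed
      moreover have "card (X - J) < card X"
        using finX e(1) J(3) by (intro psubset_card_mono) auto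
      moreover have "card (X - J) \<noteq> N - 1"
      proof -
        have "card (X - J) < card X" "card X < card U"
        proof -
          show "card (X - J) < card X"
            using finX e(1) J(3) by (intro psubset_card_mono) auto
          have "X \<subset> U" using XU \<open>X \<noteq> U\<close> by blast
          then show "card X < card U" using U_def by (intro psubset_card_mono) auto
        qed
        moreover have "card U = N" using U_def by simp
        ultimately show ?thesis by linarith
      qed
      ultimately have "card (X - J) = 1" using less.hyps cXmJ by blast
      then have XmJ: "X - J = {f e}" using feX feJ by (metis Diff_iff card_1_singletonE singletonD)
      \<comment> \<open>\<open>X - {f e} = X \<inter> J\<close> is an interval that ends at \<open>e\<close>, so \<open>f e\<close> comes first in \<open>X\<close>\<close>
      obtain v where v: "v < N" "nxt N v = f e" using nxt_surj lt eN by metis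
      have "v \<notin> X"
      proof
        assume "v \<in> X"
        moreover have "v \<noteq> f e" using v(2) nxt_neq[OF v(1)] by simp
        ultimately have "v \<in> X \<inter> J" using XmJ by blast
        moreover have "nxt N v \<notin> X \<inter> J" using v(2) feJ(1) by simp
        ultimately have "v = e"
          by (rule cyc_interval_last_unique[OF cXJ]) (use e J(3) in auto)
        then show False using v(2) e(2) feX by simp
      qed
      moreover have "odd (card X)"
        using even_card_leaving[of X] X(2) XU U_def by auto
      ultimately have "even (e + f e)"
        using cyc_interval_odd_ends[OF X(1) even_N _ e v(1)] v(2) feX by simp
      then show False using opposite[OF eN] by simp
    qed
  qed
qed

lemma partners_adjacent:
  assumes "x < N"
  shows "f (nxt N x) = nxt N (f x) \<or> f x = nxt N (f (nxt N x))"
proof -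
  define y where "y = nxt N x"
  define z where "z = nxt N y"
  define U where "U = {..<N}"
  have yN: "y < N" and zN: "z < N" using assms nxt_less by (auto simp: y_def z_def)
  have ne: "x \<noteq> y" "y \<noteq> z" "x \<noteq> z"
    using nxt_neq nxt2_neq assms yN by (auto simp: y_def z_def) metis+
  obtain w where w: "w < N" "nxt N w = x" using nxt_surj assms by blast
  obtain J where J: "cyc_interval N J" "x \<in> J" "y \<in> J" "z \<in> J" "leaving f J = {x, y}"
    using thin[OF w(1)] w(2) y_def z_def by blast
  obtain K where K: "cyc_interval N K" "x \<in> K" "y \<in> K" "z \<in> K" "leaving f K = {y, z}"
    using thin[OF assms] y_def z_def by blast
  have JU: "J \<subseteq> U" and KU: "K \<subseteq> U" using cyc_interval_subset J(1) K(1) U_def by auto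
  have Jin: "f i \<in> J \<longleftrightarrow> i \<noteq> x \<and> i \<noteq> y" if "i \<in> J" for i
    using J(5) that by (auto simp: leaving_def)
  have Kin: "f i \<in> K \<longleftrightarrow> i \<noteq> y \<and> i \<noteq> z" if "i \<in> K" for i
    using K(5) that by (auto simp: leaving_def)
  have Jout: "f i \<in> J \<longleftrightarrow> i = f x \<or> i = f y" if "i \<in> U - J" for i
    using Jin[of "f i"] Jin[of x] Jin[of y] J(2,3) that inv U_def assms yN
    by (metis Diff_iff lessThan_iff)
  have Kout: "f i \<in> K \<longleftrightarrow> i = f y \<or> i = f z" if "i \<in> U - K" for i
    using Kin[of "f i"] Kin[of y] Kin[of z] K(3,4) that inv U_def zN yN
    by (metis Diff_iff lessThan_iff)
  have u: "f x \<notin> J" "f x \<in> K" and v: "f y \<notin> J" "f y \<notin> K" and t: "f z \<in> J" "f z \<notin> K"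
    using Jin Kin J K ne by auto
  have U: "f x \<in> U" "f y \<in> U" "f z \<in> U" using lt assms yN zN U_def by auto
  \<comment> \<open>\<open>{x, y}\<close> lies outside the sets considered, so the complement of none is a single vertex\<close>
  have single: "A = {a}" if A: "cyc_interval N A" "leaving f A = {a}" "x \<notin> A" "y \<notin> A" for A a
  proof -
    have "A \<subseteq> U - {x, y}" using cyc_interval_subset[OF A(1)] A(3,4) U_def by auto
    then have "card A \<le> card (U - {x, y})" using U_def by (intro card_mono) auto
    also have "card (U - {x,y}) = N - 2" using assms yN ne U_def by (simp add: card_Diff_subset)
    finally have "card A = 1" using one_chord_cut_trivial[OF A(1,2)] four by auto
    moreover have "a \<in> A" using A(2) by (auto simp: leaving_def)
    ultimately show ?thesis by (metis card_1_singletonE singletonD)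
  qed
  have "K - J = {f x}"
  proof (rule single)
    show "cyc_interval N (K - J)" using cyc_interval_Diff[OF K(1) J(1)] t by auto
    have "i = f x" if i: "i \<in> K" "i \<notin> J" "f i \<notin> K - J" for i
    proof -
      have "i \<noteq> y \<and> i \<noteq> z" using i J by auto
      then have "f i \<in> J" using Kin i by auto
      then have "i = f x \<or> i = f y" using Jout i KU by auto
      then show ?thesis using i v by auto
    qed
    moreover have "f x \<in> leaving f (K - J)" using u J(2) inv[OF assms] by (simp add: leaving_def)
    ultimately show "leaving f (K - J) = {f x}" by (auto simp: leaving_def)
  qed (use J in auto)
  moreover have "U - (J \<union> K) = {f y}"
  proof (rule single)
    have "U - (J \<union> K) = (U - J) - K" by auto
    then show "cyc_interval N (U - (J \<union> K))"
      using cyc_interval_Diff[OF cyc_interval_compl[OF J(1)] K(1)] K(2) J(2) U_def by auto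
    have "i = f y" if i: "i \<in> U" "i \<notin> J" "i \<notin> K" "f i \<notin> U - (J \<union> K)" for i
    proof -
      have "f i \<in> J \<union> K" using i lt U_def by auto
      moreover have "i \<noteq> f x" "i \<noteq> f z" using i u(2) t(1) by auto
      ultimately show ?thesis using Jout[of i] Kout[of i] i(1-3) by simp
    qed
    moreover have "f y \<in> leaving f (U - (J \<union> K))"
      using v U(2) J(3) inv[OF yN] by (simp add: leaving_def)
    ultimately show "leaving f (U - (J \<union> K)) = {f y}" by (auto simp: leaving_def)
  qed (use J in auto)
  moreover have "U - J = (K - J) \<union> (U - (J \<union> K))" using KU by auto
  ultimately have "cyc_interval N {f x, f y}"
    using cyc_interval_compl[OF J(1)] U_def by (simp add: insert_commute)
  moreover have "f x \<noteq> f y" using inv ne(1) assms yN by metis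
  ultimately have "f y = nxt N (f x) \<or> f x = nxt N (f y)" by (rule cyc_interval_two)
  then show ?thesis unfolding y_def .
qed

lemma partner_not_next:
  assumes "i < N"
  shows "f i \<noteq> nxt N i"
proof
  assume i: "f i = nxt N i"
  have "cyc_interval N {i, nxt N i}" using cyc_interval_arc assms .
  moreover have "{i, nxt N i} \<noteq> {..<N}"
  proof
    assume "{i, nxt N i} = {..<N}"
    then have "card {i, nxt N i} = N" by simp
    moreover have "card {i, nxt N i} \<le> 2" by (simp add: card_insert_if)
    ultimately show False using four by simp
  qed
  moreover have "leaving f {i, nxt N i} = {}" using i inv[OF assms] by (auto simp: leaving_def)
  ultimately show False using connected by blast
qed

lemma antipodal:
  assumes "k < N"
  shows "f k = (k + N div 2) mod N"
proof -
  have N0: "0 < N" using four by simp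
  have fwd: "f (nxt N i) = nxt N (f i)" if "i < N" for i
  proof (rule ccontr)
    assume i: "f (nxt N i) \<noteq> nxt N (f i)"
    \<comment> \<open>a change of direction would give two vertices the same partner\<close>
    have bwd: "f j = nxt N (f (nxt N j))" if j: "j < N" for j
    proof -
      have "f ((i + m) mod N) = nxt N (f (nxt N ((i + m) mod N)))" for m
      proof (induction m)
        case 0
        then show ?case using i partners_adjacent \<open>i < N\<close> by auto
      next
        case (Suc m)
        define a where "a = (i + m) mod N"
        have a: "a < N" "nxt N a = (i + Suc m) mod N"
          using N0 nxt_eq_mod by (auto simp: a_def mod_Suc_eq)
        have na: "nxt N a < N" "nxt N (nxt N a) < N" using a nxt_less by blast+
        have "f (nxt N (nxt N a)) \<noteq> nxt N (f (nxt N a))"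
          using Suc a_def inv nxt2_neq a(1) na(2) by metis
        then show ?case using partners_adjacent[OF na(1)] a(2) by auto
      qed
      from this[of "j + N - i"] show ?thesis using that \<open>i < N\<close> by simp
    qed
    \<comment> \<open>so \<open>f\<close> is a reflection, whose axis passes through a vertex or through an arc\<close>
    have sum: "(f m + m) mod N = f 0" if "m < N" for m
      using that
    proof (induction m)
      case 0
      then show ?case using lt by simp
    next
      case (Suc m)
      have "f m = nxt N (f (Suc m))" using bwd[of m] Suc.prems by (simp add: nxt_def)
      also have "\<dots> = Suc (f (Suc m)) mod N" using nxt_eq_mod lt Suc.prems by blast
      finally have "(f m + m) mod N = (Suc (f (Suc m)) + m) mod N"
        by (simp add: mod_add_left_eq)
      then show ?case using Suc by simp
    qed
    have c: "f 0 < N" using lt N0 .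
    show False
    proof (cases "even (f 0)")
      case True
      then obtain m where m: "f 0 = 2 * m" by blast
      have "(f m + m) mod N = (m + m) mod N" using sum[of m] c m by simp
      moreover have mN: "m < N" using c m by simp
      ultimately have "f m = m" using lt[OF mN]
        using mN mod_add_right_cancel by blast
      then show False using neq mN by blast
    next
      case False
      then obtain m where m: "f 0 = 2 * m + 1" by (metis oddE)
      have "(f m + m) mod N = (Suc m + m) mod N" using sum[of m] c m by simp
      moreover have mN: "m < N" "Suc m < N" using c m four even_N by auto
      ultimately have "f m = Suc m" using lt[OF mN(1)]
        using mN mod_add_right_cancel by blast
      then show False using partner_not_next[OF mN(1)] mN by (auto simp: nxt_def)
    qed
  qed
  have shift: "f m = (f 0 + m) mod N" if "m < N" for m
    using that
  proof (induction m)
    case 0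
    then show ?case using lt by simp
  next
    case (Suc m)
    then show ?case using fwd[of m] nxt_eq_mod[of "f m"] lt[of m]
      by (simp add: nxt_def mod_Suc_eq)
  qed
  have "(2 * f 0) mod N = 0"
    using shift[OF lt[OF N0]] inv[OF N0] by (simp add: mult_2)
  then have "N dvd 2 * f 0" by auto
  moreover have "0 < f 0" "f 0 < N" using neq[OF N0] lt[OF N0] by auto
  ultimately have "2 * f 0 = N"
  proof -
    assume a: "N dvd 2 * f 0" "0 < f 0" "f 0 < N"
    from a(1) obtain r where r: "2 * f 0 = N * r" by blast
    then have "N * r < N * 2" using a by linarith
    then have "r < 2" using nat_mult_less_cancel_disj by blast
    moreover have "r \<noteq> 0" using r a by (cases r) auto
    ultimately show ?thesis using r by simp
  qed
  then have "f 0 = N div 2" by simp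
  then show ?thesis using shift[OF assms] by (simp add: add.commute)
qed

end

section \<open>Parity and primeness of diagrams\<close>

text \<open>The diagram in which the vertex \<open>i\<close> is joined to \<open>f i\<close>.\<close>

definition diagram_of :: "nat \<Rightarrow> (nat \<Rightarrow> nat) \<Rightarrow> diagram" where
  "diagram_of N f = (\<lambda>i. {i, f i}) ` {..<N}"

lemma interlaced_meets_interval:
  assumes "interlaced c d" "c \<subseteq> {p..<q}"
  shows "d \<inter> {p..<q} \<noteq> {}"
proof -
  obtain a x b y where o: "a < x" "x < b" "b < y"
    and cd: "c = {a, b} \<and> d = {x, y} \<or> c = {x, y} \<and> d = {a, b}"
    using assms(1) unfolding interlaced_def by blast
  from cd show ?thesis
  proof
    assume "c = {a, b} \<and> d = {x, y}"
    moreover from this have "x \<in> {p..<q}" using o assms(2) by auto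
    ultimately show ?thesis by blast
  next
    assume "c = {x, y} \<and> d = {a, b}"
    moreover from this have "b \<in> {p..<q}" using o assms(2) by auto
    ultimately show ?thesis by blast
  qed
qed

lemma interlaced_sym: "interlaced c d \<Longrightarrow> interlaced d c"
  unfolding interlaced_def by blast

lemma sym_interlacement_edges: "sym (interlacement_edges C)"
  by (auto intro!: symI simp: interlacement_edges_def interlaced_sym)

lemma interlaced_pair_iff:
  assumes "a < b" "{i, j} \<inter> {a, b} = {} \<or> {i, j} = {a, b}"
  shows "interlaced {a, b} {i, j} \<longleftrightarrow> (i \<in> {a<..<b}) \<noteq> (j \<in> {a<..<b})"
proof
  assume "interlaced {a, b} {i, j}"
  then obtain p x q y where o: "p < x" "x < q" "q < y"
    and cd: "{a, b} = {p, q} \<and> {i, j} = {x, y} \<or> {a, b} = {x, y} \<and> {i, j} = {p, q}"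
    unfolding interlaced_def by blast
  from cd show "(i \<in> {a<..<b}) \<noteq> (j \<in> {a<..<b})"
    using o assms(1) by (elim disjE) (auto simp: doubleton_eq_iff)
next
  assume ij: "(i \<in> {a<..<b}) \<noteq> (j \<in> {a<..<b})"
  define x y where "x = (if i \<in> {a<..<b} then i else j)" and "y = (if i \<in> {a<..<b} then j else i)"
  have xy: "{i, j} = {x, y}" "a < x" "x < b" "\<not> (a < y \<and> y < b)"
    using ij by (auto simp: x_def y_def)
  have "{a, b} \<noteq> {i, j}" using ij by (auto simp: doubleton_eq_iff)
  then have "y \<noteq> a" "y \<noteq> b" using assms(2) xy(1) by auto
  then consider "b < y" | "y < a" using xy(4) by linarith
  then show "interlaced {a, b} {i, j}"
  proof cases
    case 1
    then show ?thesis unfolding xy(1) interlaced_def using xy(2,3) by blast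
  next
    case 2
    then show ?thesis unfolding xy(1) interlaced_def using xy(2,3) by (metis insert_commute)
  qed
qed

lemma chord_diagram_pairing:
  assumes "chord_diagram n G"
  obtains f where "pairing (2 * n) f" "G = diagram_of (2 * n) f"
proof -
  have part: "\<Union>G = {..<2 * n}" "disjoint G" and two: "\<And>c. c \<in> G \<Longrightarrow> card c = 2"
    using assms unfolding chord_diagram_def partition_on_def by auto
  have same: "c = d" if "c \<in> G" "d \<in> G" "i \<in> c" "i \<in> d" for c d i
    using part(2) that unfolding disjoint_def by blast
  have "\<exists>j. j \<noteq> i \<and> {i, j} \<in> G" if "i < 2 * n" for i
  proof -
    have "i \<in> \<Union>G" using part(1) that by simp
    then obtain c where c: "c \<in> G" "i \<in> c" by blast
    obtain a b where ab: "c = {a, b}" "a \<noteq> b" using two[OF c(1)] by (auto simp: card_2_iff)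
    show ?thesis
    proof (cases "i = a")
      case True
      then have "b \<noteq> i \<and> {i, b} \<in> G" using ab c(1) by simp
      then show ?thesis by blast
    next
      case False
      then have "i = b" using ab(1) c(2) by simp
      then have "a \<noteq> i \<and> {i, a} \<in> G" using ab c(1) by (simp add: insert_commute)
      then show ?thesis by blast
    qed
  qed
  then obtain f where f: "\<And>i. i < 2 * n \<Longrightarrow> f i \<noteq> i \<and> {i, f i} \<in> G" by metis
  have lt: "f i < 2 * n" if "i < 2 * n" for i
  proof -
    have "f i \<in> \<Union>G" using f[OF that] by blast
    then show ?thesis using part(1) by simp
  qed
  have "pairing (2 * n) f"
  proof
    fix i assume i: "i < 2 * n"
    show "f i < 2 * n" "f i \<noteq> i" using lt f i by auto
    have "{i, f i} = {f i, f (f i)}"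
      using same[of "{i, f i}" "{f i, f (f i)}" "f i"] f lt i by simp
    then show "f (f i) = i" using f[OF i] f[OF lt[OF i]] by (auto simp: doubleton_eq_iff)
  qed
  moreover have "G = diagram_of (2 * n) f"
  proof
    show "G \<subseteq> diagram_of (2 * n) f"
    proof
      fix c assume c: "c \<in> G"
      then have "c \<noteq> {}" using two[OF c] by auto
      then obtain i where i: "i \<in> c" by blast
      then have "i \<in> \<Union>G" using c by blast
      then have "i < 2 * n" using part(1) by simp
      moreover from this have "c = {i, f i}" using same[OF c _ i] f by blast
      ultimately show "c \<in> diagram_of (2 * n) f" by (auto simp: diagram_of_def)
    qed
    show "diagram_of (2 * n) f \<subseteq> G" using f by (auto simp: diagram_of_def)
  qed
  ultimately show ?thesis using that by blast
qed

context pairing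
begin

lemma chord_eq: "c \<in> diagram_of N f \<Longrightarrow> i \<in> c \<Longrightarrow> c = {i, f i} \<and> i < N"
  using lt inv by (auto simp: diagram_of_def)

lemma chord_diagram_diagram_of:
  assumes "N = 2 * n"
  shows "chord_diagram n (diagram_of N f)"
proof -
  have "\<Union>(diagram_of N f) = {..<N}" using lt by (auto simp: diagram_of_def)
  moreover have "disjoint (diagram_of N f)"
    unfolding disjoint_def by (metis chord_eq disjoint_iff)
  moreover have "{} \<notin> diagram_of N f" by (auto simp: diagram_of_def)
  moreover have "card c = 2" if "c \<in> diagram_of N f" for c
    using that neq by (auto simp: diagram_of_def card_2_iff)
  ultimately show ?thesis unfolding chord_diagram_def partition_on_def assms by blast
qed

lemma interlaced_diagram_of_iff:
  assumes "a < N" "a < f a" "j < N"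
  shows "interlaced {a, f a} {j, f j} \<longleftrightarrow> (j \<in> {a<..<f a}) \<noteq> (f j \<in> {a<..<f a})"
proof (rule interlaced_pair_iff)
  show "{j, f j} \<inter> {a, f a} = {} \<or> {j, f j} = {a, f a}"
    using inv[OF assms(1)] inv[OF assms(3)] by auto
qed (rule assms)

lemma chord_ordered:
  assumes "c \<in> diagram_of N f"
  obtains a where "a < N" "a < f a" "c = {a, f a}"
proof -
  obtain i where i: "i < N" "c = {i, f i}" using assms by (auto simp: diagram_of_def)
  show ?thesis
  proof (cases "i < f i")
    case True then show ?thesis using that i by blast
  next
    case False
    then have "f i < i" using neq[OF i(1)] by simp
    then show ?thesis using that[of "f i"] i inv[OF i(1)] lt[OF i(1)] by (simp add: insert_commute)
  qed
qed

lemma card_crossings: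
  assumes "a < N" "a < f a"
  shows "card {d \<in> diagram_of N f. interlaced {a, f a} d} = card (leaving f {a<..<f a})"
proof -
  have sub: "i < N" if "i \<in> leaving f {a<..<f a}" for i
    using that lt[OF assms(1)] by (auto simp: leaving_def)
  have "inj_on (\<lambda>i. {i, f i}) (leaving f {a<..<f a})"
  proof (rule inj_onI)
    fix i j assume ij: "i \<in> leaving f {a<..<f a}" "j \<in> leaving f {a<..<f a}" "{i, f i} = {j, f j}"
    then show "i = j" unfolding doubleton_eq_iff leaving_def by blast
  qed
  moreover have "{d \<in> diagram_of N f. interlaced {a, f a} d} = (\<lambda>i. {i, f i}) ` leaving f {a<..<f a}"
  proof
    show "{d \<in> diagram_of N f. interlaced {a, f a} d} \<subseteq> (\<lambda>i. {i, f i}) ` leaving f {a<..<f a}"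
    proof
      fix d assume "d \<in> {d \<in> diagram_of N f. interlaced {a, f a} d}"
      then obtain j where j: "j < N" "d = {j, f j}" "interlaced {a, f a} {j, f j}"
        by (auto simp: diagram_of_def)
      then have "(j \<in> {a<..<f a}) \<noteq> (f j \<in> {a<..<f a})" using interlaced_diagram_of_iff assms by blast
      then have "j \<in> leaving f {a<..<f a} \<or> f j \<in> leaving f {a<..<f a}"
        using inv[OF j(1)] by (auto simp: leaving_def)
      moreover have "d = {f j, f (f j)}" using j(2) inv[OF j(1)] by auto
      ultimately show "d \<in> (\<lambda>i. {i, f i}) ` leaving f {a<..<f a}" using j(2) by blast
    qed
    show "(\<lambda>i. {i, f i}) ` leaving f {a<..<f a} \<subseteq> {d \<in> diagram_of N f. interlaced {a, f a} d}"
    proof (rule image_subsetI)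
      fix i assume i: "i \<in> leaving f {a<..<f a}"
      then have "(i \<in> {a<..<f a}) \<noteq> (f i \<in> {a<..<f a})" by (simp add: leaving_def)
      then have "interlaced {a, f a} {i, f i}" using interlaced_diagram_of_iff assms sub[OF i] by blast
      then show "{i, f i} \<in> {d \<in> diagram_of N f. interlaced {a, f a} d}"
        using sub[OF i] by (auto simp: diagram_of_def)
    qed
  qed
  ultimately show ?thesis by (simp add: card_image)
qed

lemma PC1_diagram_of_iff: "PC1 (diagram_of N f) \<longleftrightarrow> (\<forall>i<N. odd (i + f i))"
proof -
  have chord: "even (card {d \<in> diagram_of N f. interlaced {a, f a} d}) \<longleftrightarrow> odd (a + f a)"
    if a: "a < N" "a < f a" for a
  proof -
    have "even (card (leaving f {a<..<f a})) \<longleftrightarrow> even (card {a<..<f a})"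
      by (rule even_card_leaving) (use lt[OF a(1)] in auto)
    also have "\<dots> \<longleftrightarrow> odd (a + f a)"
      using a(2) by (auto dest: less_imp_Suc_add)
    finally show ?thesis using card_crossings a by simp
  qed
  show ?thesis
  proof
    assume pc: "PC1 (diagram_of N f)"
    show "\<forall>i<N. odd (i + f i)"
    proof (intro allI impI)
      fix i assume i: "i < N"
      then have "{i, f i} \<in> diagram_of N f" by (auto simp: diagram_of_def)
      then obtain a where a: "a < N" "a < f a" "{i, f i} = {a, f a}" using chord_ordered by metis
      then have "{a, f a} \<in> diagram_of N f" by (auto simp: diagram_of_def)
      then have "odd (a + f a)" using chord[OF a(1,2)] pc unfolding PC1_def by blast
      moreover have "i + f i = a + f a" using a(3) by (auto simp: doubleton_eq_iff)
      ultimately show "odd (i + f i)" by simp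
    qed
  next
    assume opp: "\<forall>i<N. odd (i + f i)"
    show "PC1 (diagram_of N f)"
      unfolding PC1_def
    proof
      fix c assume "c \<in> diagram_of N f"
      then obtain a where a: "a < N" "a < f a" "c = {a, f a}" by (rule chord_ordered)
      show "even (card {d \<in> diagram_of N f. interlaced c d})"
        unfolding a(3) using chord[OF a(1,2)] opp a(1) by blast
    qed
  qed
qed

lemma prime_imp_leaving:
  assumes prime: "prime_diagram (diagram_of N f)" and A: "cyc_interval N A" "A \<noteq> {}" "A \<noteq> {..<N}"
  shows "leaving f A \<noteq> {}"
proof -
  have interval: "leaving f {p..<q} \<noteq> {}" if pq: "p < q" "q \<le> N" "{p..<q} \<noteq> {..<N}" for p q
  proof
    assume closed: "leaving f {p..<q} = {}"
    have "{p..<q} \<subseteq> {..<N}" using pq(2) by auto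
    then obtain j where j: "j < N" "j \<notin> {p..<q}" using pq(3) by blast
    have "({p, f p}, {j, f j}) \<in> (interlacement_edges (diagram_of N f))\<^sup>*"
      using prime j pq unfolding prime_diagram_def diagram_of_def by auto
    then have "{j, f j} \<subseteq> {p..<q}"
    proof (induction rule: rtrancl_induct)
      case base
      then show ?case using closed pq by (auto simp: leaving_def)
    next
      case (step c d)
      then have d: "d \<in> diagram_of N f" "interlaced c d" by (auto simp: interlacement_edges_def)
      then obtain i where i: "i \<in> d" "i \<in> {p..<q}"
        using interlaced_meets_interval[OF d(2) step.IH] by blast
      then have "d = {i, f i}" using chord_eq d(1) by blast
      then show ?case using i closed by (auto simp: leaving_def)
    qed
    then show False using j by simp
  qed
  from A(1) show ?thesis
  proof (cases rule: cyc_interval_cases)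
    case (lin a b)
    then show ?thesis using A(2,3) interval[of a b] by auto
  next
    case (colin a b)
    have "{a..<b} \<noteq> {..<N}" "a < b" using A(2,3) colin by auto
    then have "leaving f {a..<b} \<noteq> {}" using interval colin(2) by blast
    moreover have "leaving f A = f ` leaving f {a..<b}"
      unfolding colin(3) using colin(2) by (intro leaving_compl) auto
    ultimately show ?thesis by simp
  qed
qed

text \<open>
  The interval spanned by a component \<open>Z\<close> of the interlacement graph is closed: a chord that crosses
  its boundary and is not in \<open>Z\<close> crosses no chord of \<open>Z\<close>, so it has all of \<open>Z\<close> on one side, but
  it separates the first vertex of \<open>Z\<close> from the last. Taking a component without the vertex \<open>0\<close>
  makes the interval proper.
\<close>

lemma not_prime_imp_closed:
  assumes "\<not> prime_diagram (diagram_of N f)"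
  obtains a b where "a < b" "b \<le> N" "{a..<b} \<noteq> {..<N}" "leaving f {a..<b} = {}"
proof -
  define E where "E = interlacement_edges (diagram_of N f)"
  have symE: "(d, c) \<in> E\<^sup>*" if "(c, d) \<in> E\<^sup>*" for c d
    using sym_rtrancl[OF sym_interlacement_edges] that unfolding E_def by (rule symD)
  obtain c d where cd: "c \<in> diagram_of N f" "d \<in> diagram_of N f" "(c, d) \<notin> E\<^sup>*"
    using assms unfolding prime_diagram_def E_def by blast
  obtain d0 where d0: "d0 \<in> diagram_of N f" "({0, f 0}, d0) \<notin> E\<^sup>*"
    using cd symE rtrancl_trans by metis
  define Z where "Z = {e. (d0, e) \<in> E\<^sup>*}"
  have ZC: "e \<in> diagram_of N f" if "e \<in> Z" for e
    using that d0(1) unfolding Z_def E_def interlacement_edges_def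
    by (auto elim: rtranclE)
  define V where "V = \<Union>Z"
  have VN: "V \<subseteq> {..<N}" using ZC chord_eq unfolding V_def by blast
  then have finV: "finite V" using finite_subset by blast
  have "d0 \<in> Z" unfolding Z_def by simp
  moreover have "d0 \<noteq> {}" using d0(1) by (auto simp: diagram_of_def)
  ultimately have V0: "V \<noteq> {}" unfolding V_def by blast
  have Vf: "f i \<in> V" if "i \<in> V" for i using that ZC chord_eq unfolding V_def by blast
  have zero: "0 \<notin> V"
  proof
    assume "0 \<in> V"
    then obtain e where e: "e \<in> Z" "0 \<in> e" unfolding V_def by blast
    then have "e = {0, f 0}" using chord_eq ZC by blast
    then show False using e d0(2) symE unfolding Z_def by blast
  qed
  define a b where "a = Min V" and "b = Max V"
  have ab: "a \<in> V" "b \<in> V" "\<And>i. i \<in> V \<Longrightarrow> a \<le> i \<and> i \<le> b"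
    unfolding a_def b_def using finV V0 by auto
  have closed: "f i \<in> {a..<Suc b}" if i: "i \<in> {a..<Suc b}" for i
  proof (rule ccontr)
    assume fi: "f i \<notin> {a..<Suc b}"
    have iN: "i < N" using i ab(2) VN by auto
    have "f i \<notin> V" using fi ab(3) by fastforce
    then have iV: "i \<notin> V" "f i \<notin> V" using Vf by auto
    have "{i, f i} \<in> diagram_of N f" using iN by (auto simp: diagram_of_def)
    then obtain l where l: "l < N" "l < f l" "{i, f i} = {l, f l}" using chord_ordered by metis
    then have lV: "l \<notin> V" "f l \<notin> V" using iV by (auto simp: doubleton_eq_iff)
    have lC: "{l, f l} \<in> diagram_of N f" using l by (auto simp: diagram_of_def)
    \<comment> \<open>one side of the chord \<open>{i, f i}\<close>, which is written with its smaller end first\<close>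
    define I where "I = {l..<Suc (f l)}"
    have side: "e \<subseteq> I \<or> e \<inter> I = {}" if e: "e \<in> Z" for e
    proof -
      obtain j where j: "j < N" "e = {j, f j}" using ZC[OF e] by (auto simp: diagram_of_def)
      have "\<not> interlaced {l, f l} e"
      proof
        assume "interlaced {l, f l} e"
        then have "(e, {l, f l}) \<in> E"
          using ZC[OF e] lC interlaced_sym unfolding E_def interlacement_edges_def by blast
        then have "{l, f l} \<in> Z" using e unfolding Z_def by auto
        then show False using lV unfolding V_def by blast
      qed
      then have "(j \<in> {l<..<f l}) = (f j \<in> {l<..<f l})"
        using interlaced_diagram_of_iff[OF l(1,2) j(1)] j(2) by blast
      moreover have "j \<in> V" "f j \<in> V" using e j(2) unfolding V_def by auto
      then have "j \<noteq> l" "j \<noteq> f l" "f j \<noteq> l" "f j \<noteq> f l" using lV by auto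
      ultimately show ?thesis unfolding I_def j(2) by auto
    qed
    have same: "e \<subseteq> I \<longleftrightarrow> d0 \<subseteq> I" if "(d0, e) \<in> E\<^sup>*" for e
      using that
    proof (induction rule: rtrancl_induct)
      case base
      show ?case by simp
    next
      case (step x y)
      have xy: "x \<in> Z" "y \<in> Z" using step.hyps unfolding Z_def by auto
      have int: "interlaced x y" using step.hyps(2) unfolding E_def interlacement_edges_def by simp
      have "x \<subseteq> I \<longleftrightarrow> y \<subseteq> I"
        using side[OF xy(1)] side[OF xy(2)] interlaced_meets_interval[OF int, of l "Suc (f l)"]
          interlaced_meets_interval[OF interlaced_sym[OF int], of l "Suc (f l)"]
        unfolding I_def by blast
      then show ?case using step.IH by simp
    qed
    have "i \<noteq> a" "i \<noteq> b" using iV ab by auto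
    then have ai: "a < i" "i < b" using i by auto
    show False
    proof (cases "d0 \<subseteq> I")
      case True
      then have "V \<subseteq> I" using same unfolding V_def Z_def by blast
      then have "a \<in> I" "b \<in> I" using ab by auto
      then show False using l(3) ai lV unfolding I_def by (auto simp: doubleton_eq_iff)
    next
      case False
      then have "e \<inter> I = {}" if "e \<in> Z" for e using same side that unfolding Z_def by blast
      then have "a \<notin> I" "b \<notin> I" using ab unfolding V_def by auto
      then show False using l(2,3) ai fi unfolding I_def by (auto simp: doubleton_eq_iff)
    qed
  qed
  show ?thesis
  proof (rule that)
    show "a < Suc b" using ab(3)[OF ab(1)] by simp
    show "Suc b \<le> N" using ab(2) VN by auto
    have "a \<noteq> 0" using ab(1) zero by metis
    moreover have "0 \<in> {..<N}" using ab(1) VN by auto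
    ultimately show "{a..<Suc b} \<noteq> {..<N}" by (metis atLeastLessThan_iff le_zero_eq)
    show "leaving f {a..<Suc b} = {}" using closed by (auto simp: leaving_def)
  qed
qed

end

section \<open>Undoing a teepee move\<close>

text \<open>
  Undoing a teepee move at the arc between the last two of \<open>N\<close> vertices: these vertices are deleted
  and their partners become partners of each other. At this arc the remaining vertices keep their
  numbers; other arcs are reduced to it by a rotation.
\<close>

definition merge :: "nat \<Rightarrow> (nat \<Rightarrow> nat) \<Rightarrow> nat \<Rightarrow> nat" where
  "merge N f i = (if i = f (N - 2) then f (N - 1) else if i = f (N - 1) then f (N - 2) else f i)"

context pairing
begin

text \<open>
  The hypotheses on the original diagram, in terms of its partner function: \<open>opp\<close> is PC1 and
  \<open>conn\<close> is primeness.
\<close>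

context
  fixes n assumes N: "N = 2 * n" and n: "2 \<le> n"
    and opp: "\<And>i. i < N \<Longrightarrow> odd (i + f i)"
    and conn: "\<And>A. cyc_interval N A \<Longrightarrow> A \<noteq> {} \<Longrightarrow> A \<noteq> {..<N} \<Longrightarrow> leaving f A \<noteq> {}"
begin

lemma last_partners:
  "f (N - 2) < N - 2" "f (N - 1) < N - 2" "f (N - 2) \<noteq> f (N - 1)"
proof -
  have lts: "N - 2 < N" "N - 1 < N" using N n by auto
  have inv2: "f (f (N - 2)) = N - 2" "f (f (N - 1)) = N - 1" using inv lts by auto
  have ne: "f (N - 2) \<noteq> N - 1"
  proof
    assume a: "f (N - 2) = N - 1"
    have "leaving f {N - 2..<N} = {}"
    proof -
      have "{N - 2..<N} = {N - 2, N - 1}" using lts by auto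
      then show ?thesis using a inv2(1) by (auto simp: leaving_def)
    qed
    moreover have "cyc_interval N {N - 2..<N}" by (rule cyc_interval_lin) auto
    moreover have "{N - 2..<N} \<noteq> {}" using lts by auto
    moreover have "0 \<notin> {N - 2..<N}" "0 \<in> {..<N}" using N n by auto
    ultimately show False using conn by metis
  qed
  have "f (N - 1) \<noteq> N - 2" using ne inv2 by metis
  then show "f (N - 2) < N - 2" "f (N - 1) < N - 2"
    using ne lt[OF lts(1)] lt[OF lts(2)] neq[OF lts(1)] neq[OF lts(2)] by linarith+
  have "N - 2 \<noteq> N - 1" using N n by simp
  then show "f (N - 2) \<noteq> f (N - 1)" using inv2 by metis
qed

lemma pairing_merge: "pairing (N - 2) (merge N f)"
proof
  fix i assume i: "i < N - 2"
  then have iN: "i < N" by simp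
  have lts: "N - 2 < N" "N - 1 < N" using N n by auto
  have inv2: "f (f (N - 2)) = N - 2" "f (f (N - 1)) = N - 1" using inv lts by auto
  have away: "f i < N - 2" if "i \<noteq> f (N - 2)" "i \<noteq> f (N - 1)"
  proof -
    have "f i \<noteq> N - 2" "f i \<noteq> N - 1" using that inv[OF iN] by metis+
    then show ?thesis using lt[OF iN] by linarith
  qed
  show "merge N f i < N - 2" using away last_partners by (auto simp: merge_def)
  have "f i \<noteq> f (N - 2)" "f i \<noteq> f (N - 1)"
    using inv[OF iN] inv2 i lts by force+
  then show "merge N f (merge N f i) = i"
    using last_partners(3) inv[OF iN] by (auto simp: merge_def)
  show "merge N f i \<noteq> i" using last_partners(3) neq[OF iN] by (auto simp: merge_def)
qed

lemma gauss_merge: "gauss_diagram (n - 1) (diagram_of (N - 2) (merge N f))"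
proof -
  interpret m: pairing "N - 2" "merge N f" by (rule pairing_merge)
  have lts: "N - 2 < N" "N - 1 < N" using N n by auto
  have "odd (N - 2 + f (N - 2))" "odd (N - 1 + f (N - 1))"
    using opp[OF lts(1)] opp[OF lts(2)] .
  moreover have "even (N - 2)" "odd (N - 1)" using N n by auto
  ultimately have uv: "odd (f (N - 2))" "even (f (N - 1))" unfolding even_add by blast+
  have "odd (i + merge N f i)" if "i < N - 2" for i
    using uv opp[of i] that by (auto simp: merge_def)
  then have "PC1 (diagram_of (N - 2) (merge N f))" using m.PC1_diagram_of_iff by blast
  moreover have "chord_diagram (n - 1) (diagram_of (N - 2) (merge N f))"
    by (rule m.chord_diagram_diagram_of) (use N in auto)
  ultimately show ?thesis unfolding gauss_diagram_def by blast
qed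

text \<open>
  The two vertices return on the last arc, number \<open>N - 3\<close>, of the circle with \<open>N - 2\<close> vertices.
\<close>

lemma teepee_merge: "teepee_move (n - 1) (diagram_of (N - 2) (merge N f)) (diagram_of N f)"
proof -
  interpret m: pairing "N - 2" "merge N f" by (rule pairing_merge)
  define u v p where "u = f (N - 2)" and "v = f (N - 1)" and "p = N - 3"
  define H where "H = diagram_of (N - 2) (merge N f)"
  have lts: "N - 2 < N" "N - 1 < N" using N n by auto
  have uv: "u < N - 2" "v < N - 2" "u \<noteq> v" using last_partners u_def v_def by auto
  have fuv: "f u = N - 2" "f v = N - 1" using inv lts u_def v_def by auto
  have p: "p + 1 = N - 2" "p + 2 = N - 1" "p < 2 * (n - 1)" using N n p_def by auto
  have ren: "renumber p i = i" if "i < N - 2" for i using that p(1) by (auto simp: renumber_def)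
  have mu: "merge N f u = v" "merge N f v = u" using uv(3) by (auto simp: merge_def u_def v_def)
  then have "{u, v} \<in> H" using uv(1) by (auto simp: H_def diagram_of_def intro!: image_eqI[of _ _ u])
  have rest: "H - {{u, v}} = (\<lambda>i. {i, f i}) ` ({..<N - 2} - {u, v})"
  proof -
    have H: "H = (\<lambda>i. {i, merge N f i}) ` ({..<N - 2} - {u, v}) \<union> {{u, v}}"
    proof -
      have "{..<N - 2} = ({..<N - 2} - {u, v}) \<union> {u, v}" using uv by auto
      then have "H = (\<lambda>i. {i, merge N f i}) ` (({..<N - 2} - {u, v}) \<union> {u, v})"
        unfolding H_def diagram_of_def by simp
      then show ?thesis using mu by (simp add: image_Un insert_commute)
    qed
    have "{u, v} \<notin> (\<lambda>i. {i, merge N f i}) ` ({..<N - 2} - {u, v})"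
      by (auto simp: doubleton_eq_iff)
    then have "H - {{u, v}} = (\<lambda>i. {i, merge N f i}) ` ({..<N - 2} - {u, v})"
      using H by blast
    also have "\<dots> = (\<lambda>i. {i, f i}) ` ({..<N - 2} - {u, v})"
      by (rule image_cong) (auto simp: merge_def u_def v_def)
    finally show ?thesis .
  qed
  have sub: "c \<subseteq> {..<N - 2}" if "c \<in> H" for c
    using that m.lt by (auto simp: H_def diagram_of_def)
  have "image (renumber p) ` (H - {{u, v}}) = H - {{u, v}}"
  proof -
    have "renumber p ` c = c" if "c \<in> H - {{u, v}}" for c
    proof -
      have "renumber p ` c = id ` c"
        using sub that ren by (intro image_cong) auto
      then show ?thesis by simp
    qed
    then show ?thesis by simp
  qed
  then have "split_chord H u v p = (H - {{u, v}}) \<union> {{u, N - 2}, {v, N - 1}}"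
    unfolding split_chord_def p(1,2) ren[OF uv(1)] ren[OF uv(2)] by simp
  also have "\<dots> = diagram_of N f"
  proof -
    have "{..<N} = ({..<N - 2} - {u, v}) \<union> {u, v} \<union> {N - 2, N - 1}"
      using uv lts by auto
    then have "diagram_of N f = (\<lambda>i. {i, f i}) ` (({..<N - 2} - {u, v}) \<union> {u, v} \<union> {N - 2, N - 1})"
      unfolding diagram_of_def by simp
    also have "\<dots> = (H - {{u, v}}) \<union> {{u, N - 2}, {v, N - 1}}"
      unfolding rest image_Un using fuv u_def v_def by (auto simp: insert_commute)
    finally show ?thesis by simp
  qed
  finally have "diagram_of N f = split_chord H u v p" by simp
  moreover have "PC1 (diagram_of N f)" using PC1_diagram_of_iff opp by blast
  ultimately show ?thesis
    unfolding teepee_move_def H_def[symmetric] using \<open>{u, v} \<in> H\<close> p(3) by blast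
qed

text \<open>
  A closed interval of the merged diagram that avoids the new chord, or whose complement in
  \<open>{..<N - 2}\<close> is an interval that avoids it, would be closed for \<open>f\<close>. So it contains the new chord
  and lies strictly inside \<open>{..<N - 2}\<close>; its complement in \<open>{..<N}\<close> is \<open>J\<close>.
\<close>

lemma not_prime_merge:
  assumes "\<not> prime_diagram (diagram_of (N - 2) (merge N f))"
  obtains J where "cyc_interval N J" "N - 3 \<in> J" "N - 2 \<in> J" "N - 1 \<in> J" "0 \<in> J"
    "leaving f J = {N - 2, N - 1}"
proof -
  interpret m: pairing "N - 2" "merge N f" by (rule pairing_merge)
  define u v where "u = f (N - 2)" and "v = f (N - 1)"
  have lts: "N - 2 < N" "N - 1 < N" using N n by auto
  have uv: "u < N - 2" "v < N - 2" "u \<noteq> v" using last_partners u_def v_def by auto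
  have mu: "merge N f u = v" "merge N f v = u" using uv(3) by (auto simp: merge_def u_def v_def)
  have mf: "merge N f i = f i" if "i \<noteq> u" "i \<noteq> v" for i
    using that by (simp add: merge_def u_def v_def)
  obtain a b where ab: "a < b" "b \<le> N - 2" "{a..<b} \<noteq> {..<N - 2}" "leaving (merge N f) {a..<b} = {}"
    using m.not_prime_imp_closed[OF assms] .
  have closed: "merge N f i \<in> {a..<b} \<longleftrightarrow> i \<in> {a..<b}" if "i < N - 2" for i
  proof -
    have cl: "merge N f j \<in> {a..<b}" if "j \<in> {a..<b}" for j
      using that ab(4) by (auto simp: leaving_def)
    show ?thesis using cl m.inv[OF that] by metis
  qed
  have no: False if A: "cyc_interval N A" "A \<noteq> {}" "N - 1 \<notin> A" "leaving f A = {}" for A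
    using conn[OF A(1,2)] A(3,4) lts by blast
  have u_in: "u \<in> {a..<b}"
  proof (rule ccontr)
    assume u: "u \<notin> {a..<b}"
    then have v: "v \<notin> {a..<b}" using closed[OF uv(1)] mu by simp
    have "f i \<in> {a..<b}" if "i \<in> {a..<b}" for i
      using that closed[of i] mf[of i] u v ab(2) by auto
    then have "leaving f {a..<b} = {}" by (auto simp: leaving_def)
    moreover have "cyc_interval N {a..<b}" using ab by (intro cyc_interval_lin) auto
    moreover have "N - 1 \<notin> {a..<b}" "{a..<b} \<noteq> {}" using ab(1,2) by auto
    ultimately show False using no by blast
  qed
  then have v_in: "v \<in> {a..<b}" using closed[OF uv(1)] mu by simp
  have outside: "f i < N - 2 \<and> f i \<notin> {a..<b}" if "i < N - 2" "i \<notin> {a..<b}" for i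
  proof -
    have "merge N f i = f i" using mf that u_in v_in by metis
    then show ?thesis using closed[OF that(1)] m.lt[OF that(1)] that(2) by simp
  qed
  have a0: "0 < a"
  proof (rule ccontr)
    assume "\<not> 0 < a"
    then have "a = 0" by simp
    then have "b < N - 2" using ab by (cases "b = N - 2") auto
    have "f i \<in> {b..<N - 2}" if "i \<in> {b..<N - 2}" for i
      using outside[of i] that \<open>a = 0\<close> by auto
    then have "leaving f {b..<N - 2} = {}" by (auto simp: leaving_def)
    moreover have "cyc_interval N {b..<N - 2}" using ab by (intro cyc_interval_lin) auto
    moreover have "N - 1 \<notin> {b..<N - 2}" "{b..<N - 2} \<noteq> {}" using \<open>b < N - 2\<close> by auto
    ultimately show False using no by blast
  qed
  have bN: "b < N - 2"
  proof (rule ccontr)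
    assume "\<not> b < N - 2"
    then have "b = N - 2" using ab by simp
    have "f i \<in> {0..<a}" if "i \<in> {0..<a}" for i
      using outside[of i] that \<open>b = N - 2\<close> ab(1) by auto
    then have "leaving f {0..<a} = {}" by (auto simp: leaving_def)
    moreover have "cyc_interval N {0..<a}" using ab by (intro cyc_interval_lin) auto
    moreover have "N - 1 \<notin> {0..<a}" "{0..<a} \<noteq> {}" using a0 ab(1,2) by auto
    ultimately show False using no by blast
  qed
  define J where "J = {..<N} - {a..<b}"
  show ?thesis
  proof (rule that)
    show "cyc_interval N J" unfolding J_def using ab by (intro cyc_interval_colin) auto
    show "N - 3 \<in> J" "N - 2 \<in> J" "N - 1 \<in> J" "0 \<in> J"
      unfolding J_def using a0 bN lts by auto
    show "leaving f J = {N - 2, N - 1}"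
    proof
      show "leaving f J \<subseteq> {N - 2, N - 1}"
      proof
        fix i assume i: "i \<in> leaving f J"
        then have "i < N" "i \<notin> {a..<b}" "f i \<notin> J" by (auto simp: leaving_def J_def)
        moreover from this have "\<not> i < N - 2" using outside[of i] by (auto simp: J_def)
        ultimately show "i \<in> {N - 2, N - 1}" by auto
      qed
      show "{N - 2, N - 1} \<subseteq> leaving f J"
        using u_in v_in bN lts unfolding u_def v_def by (auto simp: leaving_def J_def)
    qed
  qed
qed

end

text \<open>The same pairing, with the vertex \<open>k\<close> as the new origin.\<close>

lemma rotate:
  assumes "0 < N"
  obtains g where "pairing N g" "\<And>i. i < N \<Longrightarrow> (g i + k) mod N = f ((i + k) mod N)"
proof -
  define r where "r i = (i + k) mod N" for i
  have inj: "inj_on r {..<N}"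
    unfolding r_def by (rule inj_onI) (auto dest: mod_add_right_cancel)
  have img: "r ` {..<N} = {..<N}"
    by (rule endo_inj_surj) (use inj assms in \<open>auto simp: r_def\<close>)
  define g where "g i = inv_into {..<N} r (f (r i))" for i
  have r: "r i < N" for i using assms by (simp add: r_def)
  have rg: "r (g i) = f (r i)" for i
    unfolding g_def by (rule f_inv_into_f) (use img lt[OF r] in auto)
  have gN: "g i < N" for i
    unfolding g_def using inv_into_into[of "f (r i)" r "{..<N}"] img lt[OF r] by auto
  have "pairing N g"
  proof
    fix i assume i: "i < N"
    show "g i < N" by (rule gN)
    have "r (g (g i)) = r i" using rg inv[OF r] by simp
    then show "g (g i) = i" using inj gN i by (auto dest: inj_onD)
    show "g i \<noteq> i" using rg[of i] neq[OF r[of i]] by auto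
  qed
  then show ?thesis using that rg unfolding r_def by blast
qed

end

section \<open>Rotation and the conclusion\<close>

lemma leaving_rotate:
  assumes "pairing N g" "A \<subseteq> {..<N}"
    and rot: "\<And>i. i < N \<Longrightarrow> (g i + k) mod N = f ((i + k) mod N)"
  shows "leaving f ((\<lambda>i. (i + k) mod N) ` A) = (\<lambda>i. (i + k) mod N) ` leaving g A"
proof -
  have mem: "(j + k) mod N \<in> (\<lambda>i. (i + k) mod N) ` A \<longleftrightarrow> j \<in> A" if "j < N" for j
    using that assms(2) by (auto dest: mod_add_right_cancel)
  have "f ((i + k) mod N) \<in> (\<lambda>i. (i + k) mod N) ` A \<longleftrightarrow> g i \<in> A" if "i \<in> A" for i
  proof -
    have "i < N" using that assms(2) by auto
    then show ?thesis using mem[of "g i"] rot[of i] pairing.lt[OF assms(1)] by simp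
  qed
  then show ?thesis unfolding leaving_def by auto
qed

lemma diagram_of_rotate:
  assumes "0 < N"
    and rot: "\<And>i. i < N \<Longrightarrow> (g i + k) mod N = f ((i + k) mod N)"
  shows "diagram_of N f = image (\<lambda>i. (i + k) mod N) ` diagram_of N g"
proof -
  have "(\<lambda>i. (i + k) mod N) ` {..<N} = {..<N}"
    by (rule endo_inj_surj) (use assms in \<open>auto intro!: inj_onI dest: mod_add_right_cancel\<close>)
  then have "diagram_of N f = (\<lambda>i. {i, f i}) ` (\<lambda>i. (i + k) mod N) ` {..<N}"
    unfolding diagram_of_def by simp
  also have "\<dots> = image (\<lambda>i. (i + k) mod N) ` diagram_of N g"
    unfolding diagram_of_def image_image using rot by (intro image_cong) auto
  finally show ?thesis .
qed

lemma is_wheel_antipodal: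
  assumes "\<And>k. k < 2 * n \<Longrightarrow> f k = (k + n) mod (2 * n)"
  shows "is_wheel n (diagram_of (2 * n) f)"
proof -
  have "diagram_of (2 * n) f = wheel n"
  proof
    show "diagram_of (2 * n) f \<subseteq> wheel n"
    proof
      fix c assume "c \<in> diagram_of (2 * n) f"
      then obtain k where k: "k < 2 * n" "c = {k, f k}" by (auto simp: diagram_of_def)
      show "c \<in> wheel n"
      proof (cases "k < n")
        case True
        then show ?thesis using k assms[OF k(1)] by (auto simp: wheel_def add.commute)
      next
        case False
        then have "(k + n) mod (2 * n) = k - n"
          using k(1) by (simp add: mod_if)
        then have "c = {k - n, n + (k - n)}" "k - n < n"
          using k assms[OF k(1)] False by auto
        then show ?thesis unfolding wheel_def by blast
      qed
    qed
    show "wheel n \<subseteq> diagram_of (2 * n) f"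
    proof
      fix c assume "c \<in> wheel n"
      then obtain i where i: "i < n" "c = {i, n + i}" by (auto simp: wheel_def)
      then have "c = {i, f i}" using assms[of i] by (simp add: add.commute)
      then show "c \<in> diagram_of (2 * n) f" using i(1) by (auto simp: diagram_of_def)
    qed
  qed
  moreover have "wheel n = image (\<lambda>i. (i + 0) mod (2 * n)) ` wheel n"
  proof -
    have "image (\<lambda>i. (i + 0) mod (2 * n)) c = c" if "c \<in> wheel n" for c
      using that by (auto simp: wheel_def)
    then show ?thesis by simp
  qed
  ultimately show ?thesis unfolding is_wheel_def isomorphic_def by metis
qed

theorem theorem2:
  fixes n :: nat and G :: diagram
  assumes "n \<ge> 2"
    and "gauss_diagram n G"
    and "prime_diagram G"
    and "\<not> is_wheel n G"
  shows "\<exists>H G'. gauss_diagram (n - 1) H \<and> prime_diagram H \<and>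
           teepee_move (n - 1) H G' \<and> isomorphic n G' G"
proof (rule ccontr)
  assume none: "\<not> ?thesis"
  define N where "N = 2 * n"
  have N4: "4 \<le> N" using assms(1) N_def by simp
  obtain f where f: "pairing N f" "G = diagram_of N f"
    using chord_diagram_pairing assms(2) unfolding gauss_diagram_def N_def by blast
  interpret f: pairing N f by (rule f(1))
  have opp: "odd (i + f i)" if "i < N" for i
    using f.PC1_diagram_of_iff assms(2) f(2) that unfolding gauss_diagram_def by blast
  have conn: "leaving f A \<noteq> {}" if "cyc_interval N A" "A \<noteq> {}" "A \<noteq> {..<N}" for A
    using f.prime_imp_leaving assms(3) f(2) that by blast
  have "rigid_pairing N f"
  proof
    fix w assume w: "w < N"
    \<comment> \<open>this rotation carries the last two vertices to \<open>nxt N w\<close> and the vertex after it\<close>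
    let ?r = "\<lambda>i. (i + (w + 3)) mod N"
    obtain g where g: "pairing N g" and rot: "\<And>i. i < N \<Longrightarrow> ?r (g i) = f (?r i)"
      using f.rotate N4 by (metis less_le_trans zero_less_numeral)
    interpret g: pairing N g by (rule g)
    have oppg: "odd (i + g i)" if i: "i < N" for i
    proof -
      have par: "even (?r j) \<longleftrightarrow> even (j + (w + 3))" for j
        unfolding N_def by (simp add: dvd_mod_iff)
      have "odd (?r i + ?r (g i))" using opp[of "?r i"] rot[OF i] N4 by simp
      then show ?thesis using par by (auto simp del: add_Suc_right)
    qed
    have conng: "leaving g A \<noteq> {}" if A: "cyc_interval N A" "A \<noteq> {}" "A \<noteq> {..<N}" for A
    proof -
      have sub: "A \<subseteq> {..<N}" using cyc_interval_subset A(1) .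
      have "card (?r ` A) = card A"
        by (rule card_image) (use sub in \<open>auto intro!: inj_onI dest: mod_add_right_cancel\<close>)
      moreover have "card A < N" using psubset_card_mono[of "{..<N}" A] sub A(3) by auto
      ultimately have "?r ` A \<noteq> {..<N}" by auto
      then have "leaving f (?r ` A) \<noteq> {}" using conn cyc_interval_rot[OF A(1)] A(2) by blast
      then show ?thesis using leaving_rotate[OF g sub rot] by auto
    qed
    note ctx = N_def assms(1) oppg conng
    have "isomorphic n (diagram_of N g) G"
      unfolding isomorphic_def using diagram_of_rotate[of N g "w + 3" f, OF _ rot] N4 f(2) N_def by auto
    then have "\<not> prime_diagram (diagram_of (N - 2) (merge N g))"
      using none g.gauss_merge[OF ctx] g.teepee_merge[OF ctx] by blast
    then obtain J where J: "cyc_interval N J" "N - 3 \<in> J" "N - 2 \<in> J" "N - 1 \<in> J" "0 \<in> J"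
      "leaving g J = {N - 2, N - 1}"
      using g.not_prime_merge[OF ctx] by blast
    have r: "?r (N - 3) = w" "?r (N - 2) = nxt N w" "?r (N - 1) = nxt N (nxt N w)"
      "?r 0 = nxt N (nxt N (nxt N w))"
    proof -
      have nxt: "nxt N w = Suc w mod N" "nxt N (nxt N w) = (w + 2) mod N"
        "nxt N (nxt N (nxt N w)) = (w + 3) mod N"
        using w by (simp_all add: nxt_eq_mod nxt_less mod_Suc_eq numeral_3_eq_3)
      have sums: "N - 3 + (w + 3) = w + N" "N - 2 + (w + 3) = Suc w + N"
        "N - 1 + (w + 3) = w + 2 + N"
        using N4 by simp_all
      show "?r (N - 3) = w" using w unfolding sums by simp
      show "?r (N - 2) = nxt N w" unfolding sums nxt(1) by (rule mod_add_self2)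
      show "?r (N - 1) = nxt N (nxt N w)" unfolding sums nxt(2) by (rule mod_add_self2)
      show "?r 0 = nxt N (nxt N (nxt N w))" unfolding nxt(3) by simp
    qed
    have "leaving f (?r ` J) = ?r ` leaving g J" using leaving_rotate[OF g cyc_interval_subset[OF J(1)] rot] .
    then have "leaving f (?r ` J) = {nxt N w, nxt N (nxt N w)}" using J(6) r(2,3) by simp
    moreover have "cyc_interval N (?r ` J)" using cyc_interval_rot J(1) .
    moreover have "w \<in> ?r ` J" "nxt N w \<in> ?r ` J" "nxt N (nxt N w) \<in> ?r ` J"
      "nxt N (nxt N (nxt N w)) \<in> ?r ` J"
      using J(2-5) r image_eqI by metis+
    ultimately show "\<exists>J. cyc_interval N J \<and> w \<in> J \<and> nxt N (nxt N (nxt N w)) \<in> J \<and>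
        nxt N w \<in> J \<and> nxt N (nxt N w) \<in> J \<and> leaving f J = {nxt N w, nxt N (nxt N w)}"
      by blast
  qed (use N4 N_def opp conn in auto)
  then have "f k = (k + n) mod (2 * n)" if "k < 2 * n" for k
    using rigid_pairing.antipodal[of N f k] that unfolding N_def by simp
  then have "is_wheel n G" using is_wheel_antipodal f(2) N_def by blast
  then show False using assms(4) by simp
qed

end
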